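(* Let a finite Markov decision process be given, let $\mathcal U_F$ be the set of reward streams generated by its stationary policies, and let $\succsim$ be a preorder on the set $\mathcal U$ of all bounded real sequences. If $\succsim$ satisfies axioms A1, A2, A3, A4, A5, A6 and A7, then $\succsim$ and $\succsim_{\mathrm{AO}}$ coincide on $\mathcal U_F$; that is, for all $u,v\in\mathcal U_F$, $u\succsim v$ if and only if $u\succsim_{\mathrm{AO}}v$.
   Context: **Finite MDP.** $\mathcal S$ (states) and $\mathcal A$ (actions) are finite sets; for each $a\in\mathcal A$ there is a transition probability function $p_a(s'\mid s)$ on $\mathcal S$; and $r:\mathcal S\times\mathcal A\to\mathbb R$ is a reward function. $F$ is the set of all functions $f:\mathcal S\to\mathcal A$. For $f\in F$, $\mathbf Q(f)$ is the transition matrix with entries $\mathbf Q(f)_{s,s'}=p_{f(s)}(s'\mid s)$ and $\mathbf r(f)$ is the reward vector with entries $\mathbf r(f)_s=r(s,f(s))$. A policy is a sequence $\pi=(f_1,f_2,f_3,\dots)$ in $F$; it is stationary if it has the form $(f,f,f,\dots)$ for some $f\in F$. $\Pi_F$ is the set of stationary policies. For an initial state $s\in\mathcal S$ and a policy $\pi=(f_1,f_2,\dots)$, the generated stream $u(s,\pi)=(u_1,u_2,\dots)$ of expected rewards is $u_1=[\mathbf r(f_1)]_s$ and $u_t=[\mathbf Q(f_1)\cdots\mathbf Q(f_{t-1})\,\mathbf r(f_t)]_s$ for $t\ge 2$. $\mathcal U_F=\{u(s,\pi): s\in\mathcal S,\ \pi\in\Pi_F\}$. **Preferences.** $\mathcal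 U$ is the set of all bounded real sequences $u=(u_1,u_2,\dots)$. A preorder is a reflexive and transitive (not necessarily complete) binary relation $\succsim$. Write $u\succ v$ if $u\succsim v$ and not $v\succsim u$; write $u\sim v$ if $u\succsim v$ and $v\succsim u$. The preorder $\succsim$ compares $u$ and $v$ if $u\succsim v$ or $v\succsim u$. For $c\in\mathbb R$, $(c,u)=(c,u_1,u_2,\dots)$. For $n\ge1$, $u_{[n]}$ is obtained from $u$ by replacing $u_t$ with $0$ for all $t>n$. **Axioms.** - A1: for all $u,v\in\mathcal U$, if $u_t\ge v_t$ for all $t$ and $u_t>v_t$ for some $t$, then $u\succ v$. - A2: for all $u,v\in\mathcal U$, if $u$ can be obtained from $v$ by interchanging two entries of $v$, then $u\sim v$. - A3: for all $u,v\in\mathcal U$, if there exists $N>1$ such that $u_{[n]}\succ v_{[n]}$ for all $n\ge N$, then $u\succsim v$. - A4: for all $u,v\in\mathcal U$ and $c\in\mathbb R$, $(c,u)\succsim(c,v)$ if and only if $u\succsim v$. - A5: for all $u,v,\alpha\in\mathcal U$, if $u\succsim v$, then $u+\alpha\succsim v+\alpha$. - A6: for all $u,v\in\mathcal U_F$, $\succsim$ compares $u$ and $v$. - A7: for every $u\in\mathcal U$, $\{v\in\mathcal U: u\succsim v\}$ is a closed subset of $\mathcal U$, where $\mathcal U$ carries the metric $d(u,v)=\min\{1,\sum_{i=1}^\infty|u_i-v_i|\}$. **Average overtaking preorder.** With $\sigma_T(w)=\sum_{t=1}^T w_t$, $u\succsim_{\mathrm{AO}}v$ if and only if $\liminf_{T\to\infty}\frac1T\sum_{t=1}^T\sigma_t(u-v)\ge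 0$. *)

theory Defs
  imports "HOL-Analysis.Analysis"
begin

section \<open>Finite Markov decision processes\<close>

text \<open>
  States and actions are finite types. The number \<open>p a s s'\<close> is the probability of moving from
  \<open>s\<close> to \<open>s'\<close> under action \<open>a\<close>. Policies and streams are indexed from \<open>0\<close>: index \<open>t\<close> here is
  period \<open>t + 1\<close> in the usual numbering.
\<close>

definition transition_probs :: "('a::finite \<Rightarrow> 's::finite \<Rightarrow> 's \<Rightarrow> real) \<Rightarrow> bool" where
  "transition_probs p \<longleftrightarrow>
     (\<forall>a s. (\<forall>s'. 0 \<le> p a s s') \<and> (\<Sum>s'\<in>UNIV. p a s s') = 1)"

definition transition_matrix ::
    "('a::finite \<Rightarrow> 's::finite \<Rightarrow> 's \<Rightarrow> real) \<Rightarrow> ('s \<Rightarrow> 'a) \<Rightarrow> real ^ 's ^ 's" where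
  "transition_matrix p f = (\<chi> s s'. p (f s) s s')"

definition reward_vector ::
    "('s::finite \<Rightarrow> 'a::finite \<Rightarrow> real) \<Rightarrow> ('s \<Rightarrow> 'a) \<Rightarrow> real ^ 's" where
  "reward_vector r f = (\<chi> s. r s (f s))"

type_synonym ('s, 'a) policy = "nat \<Rightarrow> 's \<Rightarrow> 'a"

primrec transition_product ::
    "('a::finite \<Rightarrow> 's::finite \<Rightarrow> 's \<Rightarrow> real) \<Rightarrow> ('s, 'a) policy \<Rightarrow> nat \<Rightarrow> real ^ 's ^ 's" where
  "transition_product p \<pi> 0 = mat 1"
| "transition_product p \<pi> (Suc t) = transition_product p \<pi> t ** transition_matrix p (\<pi> t)"

definition reward_stream ::
    "('a::finite \<Rightarrow> 's::finite \<Rightarrow> 's \<Rightarrow> real) \<Rightarrow> ('s \<Rightarrow> 'a \<Rightarrow> real) \<Rightarrow> 's \<Rightarrow> ('s, 'a) policy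
      \<Rightarrow> nat \<Rightarrow> real" where
  "reward_stream p r s \<pi> = (\<lambda>t. (transition_product p \<pi> t *v reward_vector r (\<pi> t)) $ s)"

definition stationary_policies :: "('s, 'a) policy set" where
  "stationary_policies = {\<pi>. \<exists>f. \<pi> = (\<lambda>t. f)}"

definition stationary_streams ::
    "('a::finite \<Rightarrow> 's::finite \<Rightarrow> 's \<Rightarrow> real) \<Rightarrow> ('s \<Rightarrow> 'a \<Rightarrow> real) \<Rightarrow> (nat \<Rightarrow> real) set" where
  "stationary_streams p r = {reward_stream p r s \<pi> | s \<pi>. \<pi> \<in> stationary_policies}"


section \<open>Preferences over bounded streams\<close>

definition bounded_streams :: "(nat \<Rightarrow> real) set" where
  "bounded_streams = {u. bounded (range u)}"

text \<open>
  A preference relation is a set \<open>R\<close> of pairs of streams; \<open>(u, v) \<in> R\<close> means that \<open>u\<close> is weakly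
  preferred to \<open>v\<close>.
\<close>

definition strictly_preferred :: "(nat \<Rightarrow> real) rel \<Rightarrow> (nat \<Rightarrow> real) \<Rightarrow> (nat \<Rightarrow> real) \<Rightarrow> bool" where
  "strictly_preferred R u v \<longleftrightarrow> (u, v) \<in> R \<and> (v, u) \<notin> R"

definition indifferent :: "(nat \<Rightarrow> real) rel \<Rightarrow> (nat \<Rightarrow> real) \<Rightarrow> (nat \<Rightarrow> real) \<Rightarrow> bool" where
  "indifferent R u v \<longleftrightarrow> (u, v) \<in> R \<and> (v, u) \<in> R"

definition truncate :: "nat \<Rightarrow> (nat \<Rightarrow> real) \<Rightarrow> nat \<Rightarrow> real" where
  "truncate n u = (\<lambda>t. if t < n then u t else 0)"

text \<open>
  The sum is taken in the extended nonnegative reals, so streams whose difference is not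
  absolutely summable are at distance \<open>1\<close>.
\<close>

definition stream_dist :: "(nat \<Rightarrow> real) \<Rightarrow> (nat \<Rightarrow> real) \<Rightarrow> real" where
  "stream_dist u v = enn2real (min 1 (\<Sum>i. ennreal \<bar>u i - v i\<bar>))"

lemma ennreal_stream_dist:
  "ennreal (stream_dist u v) = min 1 (\<Sum>i. ennreal \<bar>u i - v i\<bar>)"
  unfolding stream_dist_def by (rule ennreal_enn2real) (simp add: min_less_iff_disj)

interpretation stream_metric: Metric_space bounded_streams stream_dist
proof
  fix u v w :: "nat \<Rightarrow> real"
  show "0 \<le> stream_dist u v"
    by (simp add: stream_dist_def)
  show "stream_dist u v = stream_dist v u"
    by (simp add: stream_dist_def abs_minus_commute)
  show "stream_dist u v = 0 \<longleftrightarrow> u = v"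
  proof
    assume "stream_dist u v = 0"
    then have "min 1 (\<Sum>i. ennreal \<bar>u i - v i\<bar>) = 0"
      using ennreal_stream_dist[of u v] by simp
    then have "(\<Sum>i. ennreal \<bar>u i - v i\<bar>) = 0"
      by (metis min_def zero_neq_one)
    then have "ennreal \<bar>u i - v i\<bar> = 0" for i
      using sum_le_suminf[of "\<lambda>i. ennreal \<bar>u i - v i\<bar>" "{i}"] by simp
    then show "u = v"
      by (simp add: fun_eq_iff)
  next
    assume "u = v"
    then show "stream_dist u v = 0"
      by (simp add: stream_dist_def)
  qed
  have "ennreal \<bar>u i - w i\<bar> \<le> ennreal \<bar>u i - v i\<bar> + ennreal \<bar>v i - w i\<bar>" for i
  proof -
    have "ennreal \<bar>u i - w i\<bar> \<le> ennreal (\<bar>u i - v i\<bar> + \<bar>v i - w i\<bar>)"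
      by (rule ennreal_leI) linarith
    then show ?thesis
      by (subst (asm) ennreal_plus) simp_all
  qed
  then have "(\<Sum>i. ennreal \<bar>u i - w i\<bar>) \<le> (\<Sum>i. ennreal \<bar>u i - v i\<bar> + ennreal \<bar>v i - w i\<bar>)"
    by (intro suminf_le) simp_all
  also have "\<dots> = (\<Sum>i. ennreal \<bar>u i - v i\<bar>) + (\<Sum>i. ennreal \<bar>v i - w i\<bar>)"
    by (rule suminf_add[symmetric]) simp_all
  finally have *: "(\<Sum>i. ennreal \<bar>u i - w i\<bar>) \<le> \<dots>" .
  have "min 1 (x + y) \<le> min 1 x + min 1 y" for x y :: ennreal
    by (cases "1 \<le> x"; cases "1 \<le> y") (simp_all add: min_def add_increasing add_increasing2)
  then have "ennreal (stream_dist u w) \<le> ennreal (stream_dist u v) + ennreal (stream_dist v w)"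
    unfolding ennreal_stream_dist using * by (meson min.mono order.refl order.trans)
  then have "ennreal (stream_dist u w) \<le> ennreal (stream_dist u v + stream_dist v w)"
    by (simp add: stream_dist_def)
  then show "stream_dist u w \<le> stream_dist u v + stream_dist v w"
    by (subst (asm) ennreal_le_iff) (simp_all add: stream_dist_def)
qed

definition A1_monotone :: "(nat \<Rightarrow> real) rel \<Rightarrow> bool" where
  "A1_monotone R \<longleftrightarrow>
     (\<forall>u\<in>bounded_streams. \<forall>v\<in>bounded_streams.
        (\<forall>t. u t \<ge> v t) \<and> (\<exists>t. u t > v t) \<longrightarrow> strictly_preferred R u v)"

definition A2_interchange :: "(nat \<Rightarrow> real) rel \<Rightarrow> bool" where
  "A2_interchange R \<longleftrightarrow>
     (\<forall>u\<in>bounded_streams. \<forall>v\<in>bounded_streams.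
        (\<exists>i j. i \<noteq> j \<and> u = v(i := v j, j := v i)) \<longrightarrow> indifferent R u v)"

definition A3_truncation :: "(nat \<Rightarrow> real) rel \<Rightarrow> bool" where
  "A3_truncation R \<longleftrightarrow>
     (\<forall>u\<in>bounded_streams. \<forall>v\<in>bounded_streams.
        (\<exists>N>1. \<forall>n\<ge>N. strictly_preferred R (truncate n u) (truncate n v)) \<longrightarrow> (u, v) \<in> R)"

definition A4_stationarity :: "(nat \<Rightarrow> real) rel \<Rightarrow> bool" where
  "A4_stationarity R \<longleftrightarrow>
     (\<forall>u\<in>bounded_streams. \<forall>v\<in>bounded_streams. \<forall>c.
        (case_nat c u, case_nat c v) \<in> R \<longleftrightarrow> (u, v) \<in> R)"

definition A5_translation :: "(nat \<Rightarrow> real) rel \<Rightarrow> bool" where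
  "A5_translation R \<longleftrightarrow>
     (\<forall>u\<in>bounded_streams. \<forall>v\<in>bounded_streams. \<forall>\<alpha>\<in>bounded_streams.
        (u, v) \<in> R \<longrightarrow> ((\<lambda>t. u t + \<alpha> t), (\<lambda>t. v t + \<alpha> t)) \<in> R)"

definition A6_comparable :: "(nat \<Rightarrow> real) set \<Rightarrow> (nat \<Rightarrow> real) rel \<Rightarrow> bool" where
  "A6_comparable U R \<longleftrightarrow> (\<forall>u\<in>U. \<forall>v\<in>U. (u, v) \<in> R \<or> (v, u) \<in> R)"

definition A7_closed :: "(nat \<Rightarrow> real) rel \<Rightarrow> bool" where
  "A7_closed R \<longleftrightarrow>
     (\<forall>u\<in>bounded_streams.
        closedin stream_metric.mtopology {v \<in> bounded_streams. (u, v) \<in> R})"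


section \<open>The average overtaking preorder\<close>

definition partial_sum :: "nat \<Rightarrow> (nat \<Rightarrow> real) \<Rightarrow> real" where
  "partial_sum T w = (\<Sum>t<T. w t)"

definition average_overtakes :: "(nat \<Rightarrow> real) \<Rightarrow> (nat \<Rightarrow> real) \<Rightarrow> bool" where
  "average_overtakes u v \<longleftrightarrow>
     liminf (\<lambda>T. ereal ((1 / real T) * (\<Sum>t=1..T. partial_sum t (\<lambda>i. u i - v i)))) \<ge> 0"

end

theory Submission
  imports Defs
begin

text \<open>
  Let \<open>w = u - v\<close> for two stationary streams. Some power \<open>P = Q\<^sup>k\<close> of a stochastic matrix has a
  transitive support, and such a \<open>P\<close> is a strict sup-norm contraction on the range of \<open>P - I\<close>.
  Hence, for a suitable \<open>k\<close>, \<open>w (t + k) - w t\<close> decays geometrically, and the sum \<open>W\<close> of the first \<open>k\<close>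
  delayed copies of \<open>w\<close> converges geometrically to some \<open>L\<close>.

  By A4, A5 and the comparability of \<open>w\<close> with \<open>0\<close>, \<open>w\<close> and \<open>W\<close> compare with \<open>0\<close> in the same way. If
  \<open>L \<noteq> 0\<close>, the partial sums diverge and A3 decides. If \<open>L = 0\<close>, then \<open>W\<close> is absolutely summable, and
  A7 makes it indifferent to its sum received in the first period. This sum is \<open>k\<close> times the limit
  of the averaged partial sums of \<open>w\<close>.
\<close>


section \<open>Powers of stochastic matrices\<close>

definition stochastic :: "real ^ 'n::finite ^ 'n \<Rightarrow> bool" where
  "stochastic A \<longleftrightarrow> (\<forall>i j. 0 \<le> A $ i $ j) \<and> (\<forall>i. (\<Sum>j\<in>UNIV. A $ i $ j) = 1)"

definition matrix_support :: "real ^ 'n::finite ^ 'n \<Rightarrow> 'n rel" where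
  "matrix_support A = {(i, j). 0 < A $ i $ j}"

definition matrix_power :: "real ^ 'n::finite ^ 'n \<Rightarrow> nat \<Rightarrow> real ^ 'n ^ 'n" where
  "matrix_power A n = ((**) A ^^ n) (mat 1)"

lemma matrix_power_mult_vec: "matrix_power A n *v x = (((*v) A) ^^ n) x"
  by (induction n) (simp_all add: matrix_power_def flip: matrix_vector_mul_assoc)

lemma stochastic_mult:
  assumes "stochastic A" "stochastic B"
  shows "stochastic (A ** B)"
proof -
  have "(\<Sum>j\<in>UNIV. (A ** B) $ i $ j) = 1" for i
  proof -
    have "(\<Sum>j\<in>UNIV. (A ** B) $ i $ j) = (\<Sum>l\<in>UNIV. A $ i $ l * (\<Sum>j\<in>UNIV. B $ l $ j))"
      unfolding matrix_matrix_mult_def by (simp add: sum_distrib_left) (rule sum.swap)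
    then show ?thesis
      using assms by (simp add: stochastic_def)
  qed
  then show ?thesis
    using assms by (auto simp: stochastic_def matrix_matrix_mult_def intro!: sum_nonneg)
qed

lemma stochastic_mat_1: "stochastic (mat 1)"
  by (auto simp: stochastic_def mat_def)

lemma stochastic_matrix_power: "stochastic A \<Longrightarrow> stochastic (matrix_power A n)"
  by (induction n) (simp_all add: matrix_power_def stochastic_mult stochastic_mat_1)

text \<open>All entries are nonnegative, so nothing cancels: an entry of the product is positive
  exactly when some two-step path has positive weight. This reduces the search for a suitable power
  to a question about finite relations.\<close>

lemma matrix_support_mult:
  assumes "stochastic A" "stochastic B"
  shows "matrix_support (A ** B) = matrix_support A O matrix_support B"
proof -
  have "0 < (\<Sum>l\<in>UNIV. A $ i $ l * B $ l $ j) \<longleftrightarrow> (\<exists>l. 0 < A $ i $ l \<and> 0 < B $ l $ j)" for i j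
  proof -
    have nn: "0 \<le> A $ i $ l * B $ l $ j" for l
      using assms by (simp add: stochastic_def)
    have "0 < (\<Sum>l\<in>UNIV. A $ i $ l * B $ l $ j) \<longleftrightarrow> (\<exists>l. A $ i $ l * B $ l $ j \<noteq> 0)"
      using sum_nonneg_eq_0_iff[of UNIV "\<lambda>l. A $ i $ l * B $ l $ j"] nn
      by (metis (no_types, lifting) UNIV_I finite order_less_le sum_nonneg)
    then show ?thesis
      using assms by (auto simp: stochastic_def order_less_le)
  qed
  then show ?thesis
    by (auto simp: matrix_support_def matrix_matrix_mult_def)
qed

lemma matrix_support_power:
  assumes "stochastic A"
  shows "matrix_support (matrix_power A n) = matrix_support A ^^ n"
proof (induction n)
  case 0
  show ?case
    by (auto simp: matrix_support_def matrix_power_def mat_def)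
next
  case (Suc n)
  have "matrix_support (matrix_power A (Suc n)) = matrix_support A O matrix_support (matrix_power A n)"
    using matrix_support_mult[OF assms stochastic_matrix_power[OF assms, of n]]
    by (simp add: matrix_power_def)
  \<comment> \<open>\<open>matrix_power\<close> adds its factor on the left, the relational power on
    the right.\<close>
  then show ?case
    by (simp add: Suc.IH relpow_commute)
qed

text \<open>The powers of \<open>E\<close> form a finite semigroup, which contains an idempotent.\<close>

lemma finite_relation_trans_power:
  fixes E :: "'n::finite rel"
  obtains k where "0 < k" "trans (E ^^ k)"
proof -
  \<comment> \<open>A finite type carries only finitely many relations, so two different positive
    powers coincide.\<close>
  have "\<not> inj_on (\<lambda>n. E ^^ n) {1..}"
    using finite_imageD[of "\<lambda>n. E ^^ n" "{1::nat..}"] infinite_Ici[of "1::nat"] by auto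
  then obtain a b :: nat where ab: "1 \<le> a" "a < b" "E ^^ a = E ^^ b"
    unfolding inj_on_def by (metis atLeast_iff linorder_neqE_nat)
  define d where "d = b - a"
  have d: "0 < d" "E ^^ (a + d) = E ^^ a"
    using ab by (auto simp: d_def)
  have step: "E ^^ (m + d) = E ^^ m" if "a \<le> m" for m
  proof -
    have "E ^^ (m + d) = E ^^ (a + d + (m - a))"
      using that by (intro arg_cong[of _ _ "\<lambda>n. E ^^ n"]) simp
    also have "\<dots> = E ^^ (a + (m - a))"
      by (simp only: relpow_add[of "a + d"] relpow_add[of a "m - a"] d(2))
    finally show ?thesis
      using that by simp
  qed
  have "E ^^ (m + n * d) = E ^^ m" if "a \<le> m" for m n
  proof (induction n)
    case (Suc n)
    then show ?case
      using step[of "m + n * d"] that by (simp add: ac_simps)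
  qed simp
  \<comment> \<open>The exponent \<open>a * d\<close> is at least \<open>a\<close> and a multiple of
    the period \<open>d\<close>, so adding it to itself does not change the power, which is
    therefore idempotent.\<close>
  then have "E ^^ (a * d) O E ^^ (a * d) = E ^^ (a * d)"
    using d(1) by (simp flip: relpow_add)
  then have "trans (E ^^ (a * d))"
    by (auto intro!: transI)
  with that[of "a * d"] ab d show ?thesis
    by simp
qed

section \<open>Sup-norm bounds and contraction for stochastic matrices\<close>

lemma stochastic_bound:
  assumes "stochastic A" "\<And>i. \<bar>x $ i\<bar> \<le> M"
  shows "\<bar>(A *v x) $ i\<bar> \<le> M"
proof -
  have "\<bar>(A *v x) $ i\<bar> \<le> (\<Sum>j\<in>UNIV. \<bar>A $ i $ j * x $ j\<bar>)"
    unfolding matrix_vector_mult_def by simp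
  also have "\<dots> \<le> (\<Sum>j\<in>UNIV. A $ i $ j * M)"
    using assms by (intro sum_mono) (auto simp: stochastic_def abs_mult intro!: mult_mono)
  also have "\<dots> = M"
    using assms by (simp add: stochastic_def flip: sum_distrib_right)
  finally show ?thesis .
qed

lemma stochastic_power_bound:
  assumes "stochastic A" "\<And>i. \<bar>x $ i\<bar> \<le> M"
  shows "\<bar>(((*v) A ^^ n) x) $ i\<bar> \<le> M"
  using stochastic_bound[OF stochastic_matrix_power[OF assms(1)] assms(2)]
  by (simp add: matrix_power_mult_vec)

text \<open>
  By transitivity the successors of \<open>i\<close> form a closed set. At a maximum point of \<open>x\<close> in this set,
  \<open>P x - x\<close> is nonpositive.
\<close>

lemma stochastic_contraction_upper:
  fixes P :: "real ^ 'n::finite ^ 'n"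
  assumes P: "stochastic P" and tr: "trans (matrix_support P)"
    and \<delta>: "\<And>i j. 0 < P $ i $ j \<Longrightarrow> \<delta> \<le> P $ i $ j"
    and M: "\<And>i. \<bar>(P *v x - x) $ i\<bar> \<le> M"
  shows "(P *v (P *v x - x)) $ i \<le> (1 - \<delta>) * M"
proof -
  define y where "y = P *v x - x"
  define F where "F = {j. 0 < P $ i $ j}"
  have nn: "0 \<le> P $ i $ j" and row: "(\<Sum>j\<in>UNIV. P $ i $ j) = 1" for i j
    using P by (auto simp: stochastic_def)
  have "0 \<le> M"
    using M[of i] by simp
  have "F \<noteq> {}"
  proof
    assume "F = {}"
    then have "P $ i $ j = 0" for j
      using nn[of i j] by (auto simp: F_def less_le)
    then show False
      using row[of i] by simp
  qed
  then have "Max ((\<lambda>l. x $ l) ` F) \<in> (\<lambda>l. x $ l) ` F"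
    by (intro Max_in) auto
  then obtain j where j: "j \<in> F" "Max ((\<lambda>l. x $ l) ` F) = x $ j"
    by auto
  have max: "x $ l \<le> x $ j" if "l \<in> F" for l
    unfolding j(2)[symmetric] using that by (intro Max_ge) auto
  have "(P *v x) $ j = (\<Sum>l\<in>UNIV. P $ j $ l * x $ l)"
    by (simp add: matrix_vector_mult_def)
  also have "\<dots> \<le> (\<Sum>l\<in>UNIV. P $ j $ l * x $ j)"
  proof (rule sum_mono)
    fix l
    show "P $ j $ l * x $ l \<le> P $ j $ l * x $ j"
    proof (cases "P $ j $ l = 0")
      case False
      then have "l \<in> F"
        using j(1) nn[of j l] transD[OF tr, of i j l] by (simp add: F_def matrix_support_def)
      then show ?thesis
        using max nn by (simp add: mult_left_mono)
    qed simp
  qed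
  also have "\<dots> = x $ j"
    using row by (simp flip: sum_distrib_right)
  finally have yj: "y $ j \<le> 0"
    by (simp add: y_def)
  \<comment> \<open>In row \<open>i\<close> the term of \<open>j\<close> is not positive. The other
    terms carry weight \<open>1 - P $ i $ j\<close>, at most \<open>1 - \<delta>\<close>, and values
    at most \<open>M\<close>.\<close>
  have "(P *v y) $ i = P $ i $ j * y $ j + (\<Sum>l\<in>UNIV - {j}. P $ i $ l * y $ l)"
    by (simp add: matrix_vector_mult_def sum.remove[of UNIV j])
  also have "\<dots> \<le> 0 + (\<Sum>l\<in>UNIV - {j}. P $ i $ l * M)"
  proof (rule add_mono)
    show "P $ i $ j * y $ j \<le> 0"
      using nn yj by (rule mult_nonneg_nonpos)
    show "(\<Sum>l\<in>UNIV - {j}. P $ i $ l * y $ l) \<le> (\<Sum>l\<in>UNIV - {j}. P $ i $ l * M)"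
      using M by (intro sum_mono mult_left_mono nn) (auto simp: y_def abs_le_iff)
  qed
  also have "\<dots> = (1 - P $ i $ j) * M"
    using row[of i] by (simp add: sum.remove[of UNIV j] flip: sum_distrib_right)
  also have "\<dots> \<le> (1 - \<delta>) * M"
    using \<delta>[of i j] j(1) \<open>0 \<le> M\<close> by (intro mult_right_mono) (auto simp: F_def)
  finally show ?thesis
    by (simp add: y_def)
qed

lemma matrix_vector_mult_uminus: "A *v (- x) = - (A *v (x :: real ^ 'n))"
  using matrix_vector_mult_diff_distrib[of A 0 x] by simp

text \<open>The upper bound is applied to \<open>x\<close> and to \<open>- x\<close>; the hypothesis
  on \<open>M\<close> is symmetric under negation.\<close>

lemma stochastic_contraction:
  fixes P :: "real ^ 'n::finite ^ 'n"
  assumes "stochastic P" and "trans (matrix_support P)"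
    and "\<And>i j. 0 < P $ i $ j \<Longrightarrow> \<delta> \<le> P $ i $ j"
    and M: "\<And>i. \<bar>(P *v x - x) $ i\<bar> \<le> M"
  shows "\<bar>(P *v (P *v x - x)) $ i\<bar> \<le> (1 - \<delta>) * M"
proof -
  have neg: "P *v (- x) - (- x) = - (P *v x - x)"
    by (simp add: matrix_vector_mult_uminus)
  have neg2: "P *v (P *v (- x) - (- x)) = - (P *v (P *v x - x))"
    unfolding neg by (rule matrix_vector_mult_uminus)
  have "(P *v (P *v (- x) - (- x))) $ i \<le> (1 - \<delta>) * M"
  proof (rule stochastic_contraction_upper[OF assms(1-3)])
    show "\<bar>(P *v (- x) - (- x)) $ i\<bar> \<le> M" for i
      unfolding neg using M[of i] by (simp add: abs_minus_commute)
  qed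
  then have "- (P *v (P *v x - x)) $ i \<le> (1 - \<delta>) * M"
    unfolding neg2 by (simp only: vector_uminus_component)
  moreover have "(P *v (P *v x - x)) $ i \<le> (1 - \<delta>) * M"
    by (rule stochastic_contraction_upper[OF assms])
  ultimately show ?thesis
    by linarith
qed

section \<open>Geometric decay\<close>

definition geometric_decay :: "(nat \<Rightarrow> real) \<Rightarrow> bool" where
  "geometric_decay d \<longleftrightarrow> (\<exists>C \<rho>. 0 \<le> \<rho> \<and> \<rho> < 1 \<and> (\<forall>t. \<bar>d t\<bar> \<le> C * \<rho> ^ t))"

lemma geometric_decayI:
  "0 \<le> \<rho> \<Longrightarrow> \<rho> < 1 \<Longrightarrow> (\<And>t. \<bar>d t\<bar> \<le> C * \<rho> ^ t) \<Longrightarrow> geometric_decay d"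
  by (auto simp: geometric_decay_def)

lemma geometric_decayE:
  assumes "geometric_decay d"
  obtains C \<rho> where "0 \<le> C" "0 \<le> \<rho>" "\<rho> < 1" "\<And>t. \<bar>d t\<bar> \<le> C * \<rho> ^ t"
proof -
  obtain C \<rho> where *: "0 \<le> \<rho>" "\<rho> < 1" "\<And>t. \<bar>d t\<bar> \<le> C * \<rho> ^ t"
    using assms by (auto simp: geometric_decay_def)
  \<comment> \<open>At \<open>t = 0\<close> the bound reads \<open>\<bar>d 0\<bar> \<le> C\<close>,
    which forces \<open>0 \<le> C\<close>.\<close>
  with that[of C \<rho>] *(3)[of 0] show ?thesis
    by simp
qed

lemma geometric_decay_diff:
  assumes "geometric_decay d" "geometric_decay e"
  shows "geometric_decay (\<lambda>t. d t - e t)"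
proof -
  obtain C \<rho> where d: "0 \<le> C" "0 \<le> \<rho>" "\<rho> < 1" "\<And>t. \<bar>d t\<bar> \<le> C * \<rho> ^ t"
    using assms(1) by (rule geometric_decayE) blast
  obtain D \<tau> where e: "0 \<le> D" "0 \<le> \<tau>" "\<tau> < 1" "\<And>t. \<bar>e t\<bar> \<le> D * \<tau> ^ t"
    using assms(2) by (rule geometric_decayE) blast
  show ?thesis
  proof (rule geometric_decayI)
    show "0 \<le> max \<rho> \<tau>" "max \<rho> \<tau> < 1"
      using d e by auto
    fix t
    have "\<bar>d t - e t\<bar> \<le> C * \<rho> ^ t + D * \<tau> ^ t"
      using d(4)[of t] e(4)[of t] by linarith
    also have "\<dots> \<le> C * max \<rho> \<tau> ^ t + D * max \<rho> \<tau> ^ t"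
      using d e by (intro add_mono mult_left_mono power_mono) auto
    finally show "\<bar>d t - e t\<bar> \<le> (C + D) * max \<rho> \<tau> ^ t"
      by (simp add: algebra_simps)
  qed
qed

lemma geometric_decay_shift:
  assumes "geometric_decay d"
  shows "geometric_decay (\<lambda>t. d (t + k))"
proof -
  obtain C \<rho> where d: "0 \<le> C" "0 \<le> \<rho>" "\<rho> < 1" "\<And>t. \<bar>d t\<bar> \<le> C * \<rho> ^ t"
    using assms by (rule geometric_decayE) blast
  show ?thesis
    using d(4) by (intro geometric_decayI[OF d(2,3), of _ "C * \<rho> ^ k"])
      (metis add.commute mult.assoc power_add)
qed

text \<open>The difference over \<open>m\<close> periods telescopes, so a period may be replaced by
  any multiple. This gives two streams with different periods a common one.\<close>

lemma geometric_decay_period_mult: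
  assumes "geometric_decay (\<lambda>t. u (t + k) - u t)"
  shows "geometric_decay (\<lambda>t. u (t + m * k) - u t)"
proof (induction m)
  case 0
  show ?case
    by (rule geometric_decayI[of 0 _ 0]) simp_all
next
  case (Suc m)
  \<comment> \<open>The sum of two decaying terms is written as a difference, so that
    \<open>geometric_decay_diff\<close> applies.\<close>
  have *: "geometric_decay (\<lambda>t. (u (t + m * k) - u t) - (- (u (t + m * k + k) - u (t + m * k))))"
    using geometric_decay_shift[OF assms, of "m * k"]
    by (intro geometric_decay_diff[OF Suc]) (simp only: geometric_decay_def abs_minus_cancel)
  show ?case
    using * by (simp add: algebra_simps)
qed

text \<open>Let \<open>P\<close> be the power of \<open>Q\<close> with transitive support. The
  difference between times \<open>t + k\<close> and \<open>t\<close> lies in the range of P - I, so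
  every block of \<open>k\<close> steps shrinks it by a fixed factor.\<close>

lemma stochastic_powers_asymptotically_periodic:
  fixes Q :: "real ^ 'n::finite ^ 'n"
  assumes Q: "stochastic Q"
  obtains k where "0 < k"
    "\<And>i. geometric_decay (\<lambda>t. ((((*v) Q) ^^ (t + k)) x - (((*v) Q) ^^ t) x) $ i)"
proof -
  obtain k where k: "0 < k" "trans (matrix_support Q ^^ k)"
    using finite_relation_trans_power .
  define P where "P = matrix_power Q k"
  have P: "stochastic P" "trans (matrix_support P)"
    using Q k by (simp_all add: P_def stochastic_matrix_power matrix_support_power)
  define X where "X t = ((*v) Q ^^ t) x" for t
  have PX: "P *v X t = X (t + k)" for t
    by (simp add: P_def X_def matrix_power_mult_vec add.commute[of t k] funpow_add)
  \<comment> \<open>The least positive entry of \<open>P\<close>. The inserted \<open>1/2\<close>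
    keeps \<open>1 - \<delta>\<close> positive, since it becomes a divisor below.\<close>
  define \<delta> where "\<delta> = Min (insert (1/2) {P $ i $ j | i j. 0 < P $ i $ j})"
  have fin: "finite {P $ i $ j | i j. 0 < P $ i $ j}"
    by (rule finite_subset[of _ "(\<lambda>(i, j). P $ i $ j) ` UNIV"]) auto
  then have \<delta>0: "0 < \<delta>"
    unfolding \<delta>_def by (subst Min_gr_iff) auto
  have \<delta>1: "\<delta> \<le> 1/2"
    unfolding \<delta>_def using fin by (intro Min_le) auto
  have \<delta>: "\<delta> \<le> P $ i $ j" if "0 < P $ i $ j" for i j
    unfolding \<delta>_def using fin that by (intro Min_le) auto
  have contr: "\<bar>(X (t + k + k) - X (t + k)) $ i\<bar> \<le> (1 - \<delta>) * M"
    if "\<And>i. \<bar>(X (t + k) - X t) $ i\<bar> \<le> M" for t M i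
    using stochastic_contraction[OF P \<delta>, of "X t" M i] that
    by (simp add: PX matrix_vector_mult_diff_distrib)
  define N where "N = norm x + norm x"
  have start: "\<bar>(X (t + k) - X t) $ i\<bar> \<le> N" for t i
  proof -
    have "\<bar>X t $ i\<bar> \<le> norm x" for t
      unfolding X_def by (rule stochastic_power_bound[OF Q component_le_norm_cart])
    from this[of t] this[of "t + k"] show ?thesis
      by (simp add: N_def abs_le_iff)
  qed
  have decay: "\<bar>(X (t + n * k + k) - X (t + n * k)) $ i\<bar> \<le> (1 - \<delta>) ^ n * N" for t n i
  proof (induction n arbitrary: i)
    case 0
    show ?case
      using start by simp
  next
    case (Suc n)
    show ?case
      using contr[of "t + n * k", OF Suc] by (simp add: ac_simps)
  qed
  define c where "c = 1 - \<delta>"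
  have c: "0 < c" "c < 1"
    using \<delta>0 \<delta>1 by (auto simp: c_def)
  \<comment> \<open>The root spreads the factor \<open>c\<close> of one block evenly over its
    \<open>k\<close> steps.\<close>
  define \<rho> where "\<rho> = root k c"
  have \<rho>: "0 \<le> \<rho>" "\<rho> < 1" "\<rho> ^ k = c"
    using c k by (auto simp: \<rho>_def)
  have "geometric_decay (\<lambda>t. (X (t + k) - X t) $ i)" for i
  proof (rule geometric_decayI[OF \<rho>(1,2)])
    fix t
    have "\<bar>(X (t + k) - X t) $ i\<bar> \<le> c ^ (t div k) * N"
      using decay[of "t mod k" "t div k" i] by (simp add: c_def)
    \<comment> \<open>\<open>t div k\<close> falls short of \<open>t / k\<close> by less than one
      block; the factor \<open>1 / c\<close> pays for rounding up instead.\<close>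
    also have "c ^ (t div k) = c ^ Suc (t div k) / c"
      using c by simp
    also have "c ^ Suc (t div k) = \<rho> ^ (k * Suc (t div k))"
      by (simp only: power_mult \<rho>(3))
    also have "\<rho> ^ (k * Suc (t div k)) / c * N \<le> \<rho> ^ t / c * N"
    proof -
      have "t \<le> k * Suc (t div k)"
        using dividend_less_times_div[OF k(1), of t] by simp
      then show ?thesis
        using \<rho> c by (intro mult_right_mono divide_right_mono power_decreasing) (auto simp: N_def)
    qed
    finally show "\<bar>(X (t + k) - X t) $ i\<bar> \<le> N / c * \<rho> ^ t"
      by (simp add: field_simps)
  qed
  with k(1) that show ?thesis
    by (simp add: X_def)
qed

section \<open>Streams of stationary policies\<close>

lemma transition_product_stationary:
  "transition_product p (\<lambda>t. f) n *v x = ((*v) (transition_matrix p f) ^^ n) x"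
  \<comment> \<open>\<open>transition_product\<close> grows on the right, so its newest factor acts
    on the vector first and \<open>x\<close> has to vary.\<close>
  by (induction n arbitrary: x)
    (simp_all add: matrix_vector_mul_assoc[symmetric] funpow_swap1)

lemma stochastic_transition_matrix:
  "transition_probs p \<Longrightarrow> stochastic (transition_matrix p f)"
  by (simp add: transition_probs_def stochastic_def transition_matrix_def)

lemma stationary_stream_bounded:
  assumes "transition_probs p" "u \<in> stationary_streams p r"
  shows "u \<in> bounded_streams"
proof -
  obtain s f where u: "u = (\<lambda>t. (((*v) (transition_matrix p f) ^^ t) (reward_vector r f)) $ s)"
    using assms(2) by (auto simp: stationary_streams_def stationary_policies_def reward_stream_def
        transition_product_stationary)
  have "\<bar>u t\<bar> \<le> norm (reward_vector r f)" for t
    unfolding u by (rule stochastic_power_bound[OF stochastic_transition_matrix[OF assms(1)]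
        component_le_norm_cart])
  then show ?thesis
    by (auto simp: bounded_streams_def bounded_iff)
qed

lemma stationary_stream_asymptotically_periodic:
  assumes "transition_probs p" "u \<in> stationary_streams p r"
  obtains k where "0 < k" "geometric_decay (\<lambda>t. u (t + k) - u t)"
proof -
  obtain s f where u: "u = (\<lambda>t. (((*v) (transition_matrix p f) ^^ t) (reward_vector r f)) $ s)"
    using assms(2) by (auto simp: stationary_streams_def stationary_policies_def reward_stream_def
        transition_product_stationary)
  show ?thesis
  proof (rule stochastic_powers_asymptotically_periodic[OF stochastic_transition_matrix[OF assms(1)]])
    fix k
    let ?Q = "transition_matrix p f"
    assume k: "0 < k" "\<And>i. geometric_decay (\<lambda>t. ((((*v) ?Q) ^^ (t + k)) (reward_vector r f)
      - (((*v) ?Q) ^^ t) (reward_vector r f)) $ i)"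
    show thesis
      using that[OF k(1)] k(2)[of s] by (simp add: u)
  qed
qed


section \<open>Delayed sums and averaged partial sums\<close>

text \<open>This is w + S w + ... + S^(k-1) w for the shift S that prepends a zero, the operation of
  A4 with \<open>c = 0\<close>. From \<open>t = k - 1\<close> on it is the sum of the
  \<open>k\<close> entries of \<open>w\<close> ending at \<open>t\<close>.\<close>

definition delayed_sum :: "nat \<Rightarrow> (nat \<Rightarrow> real) \<Rightarrow> nat \<Rightarrow> real" where
  "delayed_sum k w t = (\<Sum>j<k. if t < j then 0 else w (t - j))"

lemma delayed_sum_uminus: "delayed_sum k (\<lambda>t. - w t) = (\<lambda>t. - delayed_sum k w t)"
  by (auto simp: delayed_sum_def fun_eq_iff sum_negf[symmetric] intro!: sum.cong)

lemma partial_sum_uminus: "partial_sum n (\<lambda>t. - w t) = - partial_sum n w"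
  by (simp add: partial_sum_def sum_negf)

lemma partial_sum_delayed_sum:
  "partial_sum n (delayed_sum k w) = (\<Sum>j<k. partial_sum (n - j) w)"
proof -
  \<comment> \<open>A delay by \<open>j\<close> removes the last \<open>j\<close> entries from the
    partial sum; for \<open>n < j\<close> natural subtraction gives the empty sum.\<close>
  have "(\<Sum>t<n. if t < j then 0 else w (t - j)) = (\<Sum>t<n - j. w t)" for j
    by (induction n) (auto simp: Suc_diff_le)
  then show ?thesis
    unfolding partial_sum_def delayed_sum_def by (subst sum.swap) simp
qed

text \<open>Partial sums commute with delays because \<open>partial_sum 0 w = 0\<close> fits the
  zero padding. This lets the next bound be applied to a sequence of partial sums as well.\<close>

lemma delayed_sum_partial_sum:
  "delayed_sum k (\<lambda>n. partial_sum n w) n = partial_sum n (delayed_sum k w)"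
  unfolding partial_sum_delayed_sum delayed_sum_def by (rule sum.cong) (auto simp: partial_sum_def)

text \<open>Each of the \<open>k\<close> delayed copies loses fewer than \<open>k\<close> entries,
  each of size at most \<open>B\<close>. The bound is uniform in \<open>n\<close>.\<close>

lemma partial_sum_delayed_sum_bound:
  assumes "\<And>t. \<bar>w t\<bar> \<le> B"
  shows "\<bar>real k * partial_sum n w - partial_sum n (delayed_sum k w)\<bar> \<le> real k * (real k * B)"
proof -
  have "0 \<le> B"
    using assms[of 0] by simp
  have *: "\<bar>partial_sum n w - partial_sum (n - j) w\<bar> \<le> real k * B" if "j < k" for j
  proof -
    have "partial_sum n w = partial_sum (n - j) w + (\<Sum>t\<in>{n - j..<n}. w t)"
      unfolding partial_sum_def by (subst sum.union_disjoint[symmetric]) (auto intro!: sum.cong)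
    then have "\<bar>partial_sum n w - partial_sum (n - j) w\<bar> \<le> (\<Sum>t\<in>{n - j..<n}. \<bar>w t\<bar>)"
      by simp
    also have "\<dots> \<le> real (n - (n - j)) * B"
      using sum_bounded_above[of "{n - j..<n}" "\<lambda>t. \<bar>w t\<bar>" B] assms by simp
    also have "\<dots> \<le> real k * B"
      using that \<open>0 \<le> B\<close> by (intro mult_right_mono) auto
    finally show ?thesis .
  qed
  have "real k * partial_sum n w - partial_sum n (delayed_sum k w)
      = (\<Sum>j<k. partial_sum n w - partial_sum (n - j) w)"
    by (simp add: partial_sum_delayed_sum sum_subtractf)
  also have "\<bar>\<dots>\<bar> \<le> (\<Sum>j<k. \<bar>partial_sum n w - partial_sum (n - j) w\<bar>)"
    by (rule sum_abs)
  also have "\<dots> \<le> real k * (real k * B)"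
    using sum_bounded_above[of "{..<k}" "\<lambda>j. \<bar>partial_sum n w - partial_sum (n - j) w\<bar>"
      "real k * B"] * by simp
  finally show ?thesis .
qed

text \<open>The increments are summable, and \<open>V t - L\<close> is minus a tail of their series;
  the tails of a geometric series decay at its own rate.\<close>

lemma geometric_decay_tail:
  assumes "geometric_decay (\<lambda>t. V (Suc t) - V t)"
  obtains L where "geometric_decay (\<lambda>t. V t - L)"
proof -
  define d where "d t = V (Suc t) - V t" for t
  obtain C \<rho> where d: "0 \<le> C" "0 \<le> \<rho>" "\<rho> < 1" "\<And>t. \<bar>d t\<bar> \<le> C * \<rho> ^ t"
    using assms unfolding d_def by (rule geometric_decayE) blast
  have geo: "summable (\<lambda>t. C * \<rho> ^ t)"
    using d by (intro summable_mult summable_geometric) simp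
  then have sd: "summable d"
    by (rule summable_comparison_test'[where N = 0]) (use d in simp)
  define L where "L = V 0 + suminf d"
  have "\<bar>V t - L\<bar> \<le> C / (1 - \<rho>) * \<rho> ^ t" for t
  proof -
    have "V t = V 0 + (\<Sum>i<t. d i)"
      unfolding d_def by (simp add: sum_lessThan_telescope)
    moreover have "suminf d = (\<Sum>i. d (i + t)) + (\<Sum>i<t. d i)"
      by (rule suminf_split_initial_segment[OF sd])
    ultimately have "\<bar>V t - L\<bar> = norm (\<Sum>i. d (i + t))"
      by (simp add: L_def)
    also have "\<dots> \<le> (\<Sum>i. C * \<rho> ^ (i + t))"
      using d geo by (intro norm_suminf_le) (auto simp: summable_iff_shift[of "\<lambda>t. C * \<rho> ^ t"])
    also have "\<dots> = C * \<rho> ^ t * (\<Sum>i. \<rho> ^ i)"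
      using d by (subst suminf_mult[symmetric]) (auto simp: power_add ac_simps summable_geometric)
    also have "\<dots> = C / (1 - \<rho>) * \<rho> ^ t"
      using d by (simp add: suminf_geometric)
    finally show ?thesis .
  qed
  with d that show ?thesis
    by (metis geometric_decayI)
qed

lemma geometric_decay_summable:
  assumes "geometric_decay d"
  shows "summable (\<lambda>t. \<bar>d t\<bar>)"
proof -
  obtain C \<rho> where d: "0 \<le> C" "0 \<le> \<rho>" "\<rho> < 1" "\<And>t. \<bar>d t\<bar> \<le> C * \<rho> ^ t"
    using assms by (rule geometric_decayE) blast
  have "summable (\<lambda>t. C * \<rho> ^ t)"
    using d by (intro summable_mult summable_geometric) simp
  then show ?thesis
    by (rule summable_comparison_test'[where N = 0]) (use d in simp)
qed

text \<open>Moving the window by one step adds one entry and drops the one \<open>k\<close> steps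
  earlier, so the increments are the decaying differences of \<open>w\<close>. The offset
  \<open>k\<close> skips the zero padding.\<close>

lemma delayed_sum_limit:
  assumes "geometric_decay (\<lambda>t. w (t + k) - w t)"
  obtains L where "geometric_decay (\<lambda>t. delayed_sum k w (t + k) - L)"
proof (rule geometric_decay_tail[of "\<lambda>t. delayed_sum k w (t + k)"])
  have "delayed_sum k w (Suc t + k) - delayed_sum k w (t + k) = w (t + 1 + k) - w (t + 1)" for t
  proof -
    have eq: "delayed_sum k w (s + k) = (\<Sum>j<k. w (s + k - j))" for s
      unfolding delayed_sum_def by (rule sum.cong) auto
    have "delayed_sum k w (Suc t + k) - delayed_sum k w (t + k)
        = (\<Sum>j<k. w (Suc (t + k) - j) - w (Suc (t + k) - Suc j))"
      using eq[of "Suc t"] by (simp add: eq sum_subtractf)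
    also have "\<dots> = w (Suc (t + k)) - w (Suc (t + k) - k)"
      by (subst sum_lessThan_telescope') simp
    finally show ?thesis
      by simp
  qed
  then show "geometric_decay
      (\<lambda>t. delayed_sum k w (Suc t + k) - delayed_sum k w (t + k))"
    using geometric_decay_shift[OF assms, of 1] by simp
qed (rule that)

section \<open>Divergent partial sums, Cesaro means and average overtaking\<close>

lemma partial_sum_at_top:
  assumes "0 < \<epsilon>" "eventually (\<lambda>t. \<epsilon> \<le> x t) sequentially"
  shows "filterlim (\<lambda>n. partial_sum n x) at_top sequentially"
proof -
  obtain N where N: "\<And>t. N \<le> t \<Longrightarrow> \<epsilon> \<le> x t"
    using assms(2) by (auto simp: eventually_sequentially)
  have "partial_sum N x + real n * \<epsilon> \<le> partial_sum (n + N) x" for n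
  proof (induction n)
    case (Suc n)
    then show ?case
      using N[of "n + N"] by (simp add: partial_sum_def algebra_simps)
  qed simp
  moreover have "filterlim (\<lambda>n. partial_sum N x + real n * \<epsilon>) at_top sequentially"
    using assms(1) by (intro filterlim_tendsto_add_at_top[OF tendsto_const]
        filterlim_at_top_mult_tendsto_pos[OF tendsto_const] filterlim_real_sequentially) auto
  ultimately have "filterlim (\<lambda>n. partial_sum (n + N) x) at_top sequentially"
    by (intro filterlim_at_top_mono[of _ sequentially "\<lambda>n. partial_sum (n + N) x"]) auto
  then show ?thesis
    unfolding filterlim_at_top using eventually_sequentially_seg by blast
qed

text \<open>For \<open>T > 0\<close> the mean exceeds \<open>b\<close> exactly when the sum of the
  terms \<open>x t - b\<close> is positive. These sums diverge because the terms are eventually at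
  least \<open>c - b\<close>.\<close>

lemma mean_lower_bound:
  fixes x :: "nat \<Rightarrow> real"
  assumes "eventually (\<lambda>t. c \<le> x t) sequentially" "b < c"
  shows "eventually (\<lambda>T. b < (1 / real T) * (\<Sum>t=1..T. x t)) sequentially"
proof -
  \<comment> \<open>The mean runs over \<open>t = 1..T\<close>, hence the shift by
    \<open>Suc\<close>.\<close>
  have ev: "eventually (\<lambda>t. c - b \<le> x (Suc t) - b) sequentially"
    using assms(1) by (subst (asm) eventually_sequentially_Suc[symmetric]) simp
  have "filterlim (\<lambda>n. partial_sum n (\<lambda>t. x (Suc t) - b)) at_top sequentially"
    by (rule partial_sum_at_top[OF _ ev]) (use assms in simp)
  then have "eventually (\<lambda>T. 0 < partial_sum T (\<lambda>t. x (Suc t) - b)) sequentially"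
    by (simp add: filterlim_at_top_dense)
  then show ?thesis
    using eventually_gt_at_top[of 0]
  proof eventually_elim
    case (elim T)
    have "partial_sum T (\<lambda>t. x (Suc t) - b) = (\<Sum>t=1..T. x t) - real T * b"
      unfolding partial_sum_def
      by (simp add: sum_subtractf sum.atLeast1_atMost_eq)
    then show ?case
      using elim by (simp add: field_simps)
  qed
qed

text \<open>Cesaro's theorem: the lower side is the previous bound, the upper side is the same bound
  for \<open>- x\<close>.\<close>

lemma mean_tendsto:
  fixes x :: "nat \<Rightarrow> real"
  assumes "x \<longlonglongrightarrow> l"
  shows "(\<lambda>T. (1 / real T) * (\<Sum>t=1..T. x t)) \<longlonglongrightarrow> l"
proof (rule order_tendstoI)
  fix a assume "a < l"
  then obtain c where c: "a < c" "c < l"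
    using dense by blast
  have "eventually (\<lambda>t. c \<le> x t) sequentially"
    using order_tendstoD(1)[OF assms c(2)] by eventually_elim simp
  then show "eventually (\<lambda>T. a < (1 / real T) * (\<Sum>t=1..T. x t)) sequentially"
    using c(1) by (rule mean_lower_bound)
next
  fix a assume "l < a"
  then obtain c where c: "l < c" "c < a"
    using dense by blast
  have "eventually (\<lambda>t. - c \<le> - x t) sequentially"
    using order_tendstoD(2)[OF assms c(1)] by eventually_elim simp
  then have "eventually (\<lambda>T. - a < (1 / real T) * (\<Sum>t=1..T. - x t)) sequentially"
    using c(2) by (intro mean_lower_bound[where c = "- c"]) auto
  then show "eventually (\<lambda>T. (1 / real T) * (\<Sum>t=1..T. x t) < a) sequentially"
    by (simp add: sum_negf)
qed

text \<open>Trades the extended-real lower limit for real inequalities that hold eventually, a form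
  that also suits divergent means.\<close>

lemma average_overtakes_iff:
  "average_overtakes u v \<longleftrightarrow> (\<forall>b<0. eventually
     (\<lambda>T. b < (1 / real T) * (\<Sum>t=1..T. partial_sum t (\<lambda>i. u i - v i))) sequentially)"
  (is "_ \<longleftrightarrow> (\<forall>b<0. eventually (\<lambda>T. b < ?m T) sequentially)")
proof
  assume "average_overtakes u v"
  then have le: "ereal 0 \<le> liminf (\<lambda>T. ereal (?m T))"
    by (simp add: average_overtakes_def zero_ereal_def)
  have "eventually (\<lambda>T. b < ?m T) sequentially" if "b < 0" for b
    using le[unfolded le_Liminf_iff, rule_format, of "ereal b"] that by simp
  then show "\<forall>b<0. eventually (\<lambda>T. b < ?m T) sequentially"
    by blast
next
  assume *: "\<forall>b<0. eventually (\<lambda>T. b < ?m T) sequentially"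
  have "ereal 0 \<le> liminf (\<lambda>T. ereal (?m T))"
    unfolding le_Liminf_iff
  proof safe
    fix y :: ereal
    assume "y < ereal 0"
    with * show "eventually (\<lambda>T. y < ereal (?m T)) sequentially"
      by (cases y) auto
  qed
  then show "average_overtakes u v"
    by (simp add: average_overtakes_def zero_ereal_def)
qed

lemma average_overtakes_limit:
  assumes "(\<lambda>T. (1 / real T) * (\<Sum>t=1..T. partial_sum t (\<lambda>i. u i - v i))) \<longlonglongrightarrow> l"
  shows "average_overtakes u v \<longleftrightarrow> 0 \<le> l"
proof
  assume "average_overtakes u v"
  then have *: "eventually (\<lambda>T. b < (1 / real T) * (\<Sum>t=1..T. partial_sum t (\<lambda>i. u i - v i)))
      sequentially" if "b < 0" for b
    using that by (simp only: average_overtakes_iff)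
  have "b \<le> l" if "b < 0" for b
    by (rule tendsto_lowerbound[OF assms eventually_mono[OF *[OF that]]]) auto
  then show "0 \<le> l"
    by (rule dense_le)
next
  assume "0 \<le> l"
  then show "average_overtakes u v"
    unfolding average_overtakes_iff using order_tendstoD(1)[OF assms] less_le_trans by blast
qed

text \<open>The partial sums \<open>S\<close> of \<open>w\<close> may oscillate, but
  \<open>delayed_sum k S\<close> is the convergent sequence \<open>U\<close>. The bound for delayed
  sums is used twice: for \<open>w\<close> it shows that \<open>S\<close> is bounded, and for
  \<open>S\<close> it keeps \<open>k\<close> times the sums of \<open>S\<close> within a bounded
  distance of the sums of \<open>U\<close>. Division by \<open>T\<close> removes this error.\<close>

lemma mean_partial_sum_tendsto:
  assumes B: "\<And>t. \<bar>w t\<bar> \<le> B" and k: "0 < k"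
    and lim: "(\<lambda>n. partial_sum n (delayed_sum k w)) \<longlonglongrightarrow> m"
  shows "(\<lambda>T. (1 / real T) * (\<Sum>t=1..T. partial_sum t w)) \<longlonglongrightarrow> m / real k"
proof -
  define S where "S n = partial_sum n w" for n
  define U where "U n = partial_sum n (delayed_sum k w)" for n
  have S_U: "delayed_sum k S = U"
    unfolding S_def U_def fun_eq_iff by (simp add: delayed_sum_partial_sum)
  have U: "U \<longlonglongrightarrow> m"
    using lim by (simp add: U_def[abs_def])
  obtain D where D: "\<And>n. \<bar>U n\<bar> \<le> D"
    using convergent_imp_Bseq[OF convergentI[OF U]] by (auto simp: Bseq_def)
  define E where "E = (D + real k * (real k * B)) / real k"
  have S_bound: "\<bar>S n\<bar> \<le> E" for n
  proof -
    have "\<bar>real k * S n - U n\<bar> \<le> real k * (real k * B)"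
      unfolding S_def U_def by (rule partial_sum_delayed_sum_bound[OF B])
    then have "\<bar>real k * S n\<bar> \<le> D + real k * (real k * B)"
      using D[of n] by linarith
    then have "real k * \<bar>S n\<bar> \<le> D + real k * (real k * B)"
      by (simp only: abs_mult abs_of_nat)
    then show ?thesis
      using k unfolding E_def by (simp only: pos_le_divide_eq of_nat_0_less_iff mult.commute)
  qed
  define MS where "MS T = (1 / real T) * (\<Sum>t=1..T. S t)" for T
  define MU where "MU T = (1 / real T) * (\<Sum>t=1..T. U t)" for T
  define F where "F = real k * (real k * E)"
  \<comment> \<open>A sequence that vanishes at 0 has the same sum over \<open>1..T\<close> as over
    the first \<open>Suc T\<close> indices.\<close>
  have sums: "(\<Sum>t=1..T. x t) = partial_sum (Suc T) x" if "x 0 = 0" for x :: "nat \<Rightarrow> real" and T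
    unfolding partial_sum_def sum.lessThan_Suc_shift using that
    by (simp only: One_nat_def sum.atLeast_Suc_atMost_Suc_shift) (simp add: sum.atLeast1_atMost_eq)
  have 0: "S 0 = 0" "U 0 = 0"
    by (simp_all add: S_def U_def partial_sum_def)
  have le: "norm (real k * MS T - MU T) \<le> F * (1 / real T)" for T
  proof -
    have "real k * MS T - MU T = (real k * partial_sum (Suc T) S - partial_sum (Suc T) U) * (1 / real T)"
      unfolding MS_def MU_def sums[of S, OF 0(1)] sums[of U, OF 0(2)]
      by (simp only: left_diff_distrib mult.assoc mult.commute[of "1 / real T"])
    then have "norm (real k * MS T - MU T)
        = \<bar>real k * partial_sum (Suc T) S - partial_sum (Suc T) U\<bar> * (1 / real T)"
      by (simp only: real_norm_def abs_mult) simp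
    also have "\<dots> \<le> F * (1 / real T)"
      unfolding F_def S_U[symmetric]
      by (intro mult_right_mono partial_sum_delayed_sum_bound S_bound) simp
    finally show ?thesis .
  qed
  have "(\<lambda>T. F * (1 / real T)) \<longlonglongrightarrow> 0"
    by (intro tendsto_mult_right_zero lim_1_over_n)
  then have "(\<lambda>T. real k * MS T - MU T) \<longlonglongrightarrow> 0"
    by (rule Lim_null_comparison[OF always_eventually[OF allI[OF le]]])
  moreover have "MU \<longlonglongrightarrow> m"
    unfolding MU_def[abs_def] by (rule mean_tendsto[OF U])
  ultimately have "(\<lambda>T. (real k * MS T - MU T) + MU T) \<longlonglongrightarrow> 0 + m"
    by (rule tendsto_add)
  then have "(\<lambda>T. real k * MS T) \<longlonglongrightarrow> m"
    by simp
  then have "(\<lambda>T. real k * MS T / real k) \<longlonglongrightarrow> m / real k"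
    using k by (intro tendsto_divide tendsto_const) auto
  then show ?thesis
    using k by (simp add: MS_def S_def)
qed


section \<open>Preferences over bounded streams\<close>

lemma bounded_streams_iff: "u \<in> bounded_streams \<longleftrightarrow> (\<exists>B. \<forall>t. \<bar>u t\<bar> \<le> B)"
  by (auto simp: bounded_streams_def bounded_iff)

lemma bounded_streams_add:
  "u \<in> bounded_streams \<Longrightarrow> v \<in> bounded_streams \<Longrightarrow> (\<lambda>t. u t + v t) \<in> bounded_streams"
  unfolding bounded_streams_iff by (meson abs_triangle_ineq add_mono order_trans)

lemma bounded_streams_uminus: "u \<in> bounded_streams \<Longrightarrow> (\<lambda>t. - u t) \<in> bounded_streams"
  unfolding bounded_streams_iff by simp

lemma bounded_streams_diff:
  "u \<in> bounded_streams \<Longrightarrow> v \<in> bounded_streams \<Longrightarrow> (\<lambda>t. u t - v t) \<in> bounded_streams"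
  using bounded_streams_add[OF _ bounded_streams_uminus] by simp

lemma bounded_streams_zero: "(\<lambda>t. 0) \<in> bounded_streams"
  unfolding bounded_streams_iff by auto

lemma bounded_streams_truncate: "truncate n u \<in> bounded_streams"
proof -
  have "\<bar>truncate n u t\<bar> \<le> (\<Sum>i<n. \<bar>u i\<bar>)" for t
    by (auto simp: truncate_def intro!: member_le_sum sum_nonneg)
  then show ?thesis
    unfolding bounded_streams_iff by blast
qed

definition impulse :: "nat \<Rightarrow> real \<Rightarrow> nat \<Rightarrow> real" where
  "impulse n c = (\<lambda>t. if t = n then c else 0)"

lemma bounded_streams_impulse: "impulse n c \<in> bounded_streams"
  unfolding bounded_streams_iff impulse_def by (auto intro!: exI[of _ "\<bar>c\<bar>"])

lemmas bounded_streams_intros =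
  bounded_streams_add bounded_streams_uminus bounded_streams_diff bounded_streams_zero
  bounded_streams_truncate bounded_streams_impulse

lemma stream_dist_le:
  assumes "\<And>m. (\<Sum>i<m. \<bar>u i - v i\<bar>) \<le> B"
  shows "stream_dist u v \<le> B"
proof -
  have "0 \<le> B"
    using assms[of 0] by simp
  have "(\<Sum>i. ennreal \<bar>u i - v i\<bar>) \<le> ennreal B"
    using assms by (intro suminf_le_const summableI) (simp add: sum_ennreal ennreal_leI)
  then have "min 1 (\<Sum>i. ennreal \<bar>u i - v i\<bar>) \<le> ennreal B"
    by (rule min.coboundedI2)
  then have "stream_dist u v \<le> enn2real (ennreal B)"
    unfolding stream_dist_def by (intro enn2real_mono) auto
  then show ?thesis
    using \<open>0 \<le> B\<close> by simp
qed

section \<open>Consequences of the axioms for differences of streams\<close>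

locale preference =
  fixes R :: "(nat \<Rightarrow> real) rel"
  assumes preorder: "preorder_on bounded_streams R"
    and A1: "A1_monotone R"
    and A2: "A2_interchange R"
    and A3: "A3_truncation R"
    and A4: "A4_stationarity R"
    and A5: "A5_translation R"
    and A7: "A7_closed R"
begin

text \<open>By A5 this set determines the relation on bounded streams; the axioms turn into closure
  properties of it.\<close>

definition improving :: "(nat \<Rightarrow> real) \<Rightarrow> bool" where
  "improving w \<longleftrightarrow> (w, \<lambda>t. 0) \<in> R"

lemma R_bounded: "(u, v) \<in> R \<Longrightarrow> u \<in> bounded_streams \<and> v \<in> bounded_streams"
  using preorder by (auto simp: preorder_on_def)

lemma improving_bounded: "improving w \<Longrightarrow> w \<in> bounded_streams"
  using R_bounded by (auto simp: improving_def)

lemma R_refl: "u \<in> bounded_streams \<Longrightarrow> (u, u) \<in> R"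
  using preorder by (auto simp: preorder_on_def refl_on_def)

lemma R_trans: "(u, v) \<in> R \<Longrightarrow> (v, w) \<in> R \<Longrightarrow> (u, w) \<in> R"
  using preorder by (auto simp: preorder_on_def dest: transD)

lemma R_translate:
  assumes "(u, v) \<in> R" "\<alpha> \<in> bounded_streams"
  shows "((\<lambda>t. u t + \<alpha> t), (\<lambda>t. v t + \<alpha> t)) \<in> R"
  using A5 assms R_bounded[OF assms(1)] by (auto simp: A5_translation_def)

lemma R_iff_improving:
  assumes "u \<in> bounded_streams" "v \<in> bounded_streams"
  shows "(u, v) \<in> R \<longleftrightarrow> improving (\<lambda>t. u t - v t)"
proof
  assume "(u, v) \<in> R"
  from R_translate[OF this bounded_streams_uminus[OF assms(2)]] show "improving (\<lambda>t. u t - v t)"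
    by (simp add: improving_def)
next
  assume "improving (\<lambda>t. u t - v t)"
  then have "((\<lambda>t. u t - v t), (\<lambda>t. 0)) \<in> R"
    by (simp add: improving_def)
  from R_translate[OF this assms(2)] show "(u, v) \<in> R"
    by simp
qed

lemma improving_zero: "improving (\<lambda>t. 0)"
  by (simp add: improving_def R_refl bounded_streams_zero)

text \<open>By translation \<open>u + v\<close> is weakly preferred to \<open>v\<close>, and
  \<open>v\<close> is weakly preferred to zero.\<close>

lemma improving_add:
  assumes "improving u" "improving v"
  shows "improving (\<lambda>t. u t + v t)"
proof -
  have "((\<lambda>t. u t + v t), (\<lambda>t. 0 + v t)) \<in> R"
    using assms(1) improving_bounded[OF assms(2)] unfolding improving_def by (rule R_translate)
  then show ?thesis
    using assms(2) R_trans by (simp add: improving_def)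
qed

lemma improving_sum:
  assumes "finite J" "\<And>j. j \<in> J \<Longrightarrow> improving (x j)"
  shows "improving (\<lambda>t. \<Sum>j\<in>J. x j t)"
  using assms by (induction J rule: finite_induct) (auto intro!: improving_zero improving_add)

text \<open>A4 with \<open>c = 0\<close> prepends a zero to both sides, which leaves the zero stream
  unchanged.\<close>

lemma improving_delay:
  assumes "improving w"
  shows "improving (\<lambda>t. if t < j then 0 else w (t - j))"
proof (induction j)
  case 0
  show ?case
    using assms by simp
next
  case (Suc j)
  define x where "x = (\<lambda>t. if t < j then 0 else w (t - j))"
  have "improving x"
    using Suc by (simp add: x_def)
  then have "(case_nat 0 x, case_nat 0 (\<lambda>t. 0)) \<in> R"
    using A4 improving_bounded[OF \<open>improving x\<close>] bounded_streams_zero by (simp add: A4_stationarity_def improving_def)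
  moreover have "case_nat 0 (\<lambda>t. 0 :: real) = (\<lambda>t. 0)"
    by (simp add: fun_eq_iff split: nat.split)
  moreover have "case_nat 0 x = (\<lambda>t. if t < Suc j then 0 else w (t - Suc j))"
    by (simp add: fun_eq_iff x_def split: nat.split)
  ultimately show ?case
    by (simp add: improving_def)
qed

lemma improving_delayed_sum:
  assumes "improving w"
  shows "improving (delayed_sum k w)"
proof -
  have "delayed_sum k w = (\<lambda>t. \<Sum>j<k. if t < j then 0 else w (t - j))"
    by (simp add: delayed_sum_def fun_eq_iff)
  then show ?thesis
    using improving_sum[of "{..<k}" "\<lambda>j t. if t < j then 0 else w (t - j)"] improving_delay[OF assms] by simp
qed

text \<open>\<open>- w\<close> is minus the delayed sum plus the copies with positive delay, and
  these copies are improving along with \<open>w\<close>.\<close>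

lemma improving_uminus_of_delayed_sum:
  assumes "improving w" "0 < k" "improving (\<lambda>t. - delayed_sum k w t)"
  shows "improving (\<lambda>t. - w t)"
proof -
  let ?d = "\<lambda>j t. if t < j then 0 else w (t - j)"
  have "improving (\<lambda>t. - delayed_sum k w t + (\<Sum>j\<in>{..<k} - {0}. ?d j t))"
    using improving_sum[of "{..<k} - {0}" ?d] improving_delay[OF assms(1)] by (intro improving_add assms(3)) auto
  moreover have "- delayed_sum k w t + (\<Sum>j\<in>{..<k} - {0}. ?d j t) = - w t" for t
    unfolding delayed_sum_def using assms(2) by (subst sum.remove[of _ 0]) auto
  ultimately show ?thesis
    by simp
qed

text \<open>Comparability serves the backward direction: if \<open>w\<close> were not improving,
  \<open>- w\<close> would be, and the previous lemma for \<open>- w\<close> would make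
  \<open>w\<close> improving after all.\<close>

lemma improving_iff_improving_delayed_sum:
  assumes "improving w \<or> improving (\<lambda>t. - w t)" "0 < k"
  shows "improving w \<longleftrightarrow> improving (delayed_sum k w)"
proof
  assume V: "improving (delayed_sum k w)"
  show "improving w"
  proof (rule ccontr)
    assume "\<not> improving w"
    with assms have "improving (\<lambda>t. - w t)"
      by simp
    from improving_uminus_of_delayed_sum[OF this assms(2)] V \<open>\<not> improving w\<close> show False
      by (simp add: delayed_sum_uminus)
  qed
qed (rule improving_delayed_sum)

section \<open>Impulses and truncated streams\<close>

lemma improving_impulse_iff: "improving (impulse 0 c) \<longleftrightarrow> 0 \<le> c"
proof -
  have pos: "improving (impulse 0 a)" "\<not> improving (impulse 0 (- a))" if "0 < a" for a
  proof -
    have "strictly_preferred R (impulse 0 a) (\<lambda>t. 0)"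
      using A1[unfolded A1_monotone_def, rule_format, OF bounded_streams_impulse bounded_streams_zero]
        that by (auto simp: impulse_def)
    moreover have "(\<lambda>t. 0 - impulse 0 a t) = impulse 0 (- a)"
      by (simp add: impulse_def fun_eq_iff)
    ultimately show "improving (impulse 0 a)" "\<not> improving (impulse 0 (- a))"
      using R_iff_improving[OF bounded_streams_zero bounded_streams_impulse[of 0 a]]
      by (auto simp: strictly_preferred_def improving_def)
  qed
  have "impulse 0 0 = (\<lambda>t. 0)"
    by (simp add: impulse_def fun_eq_iff)
  then show ?thesis
    using pos[of c] pos[of "- c"] improving_zero by (cases c "0 :: real" rule: linorder_cases) auto
qed

text \<open>A2 exchanges entries 0 and \<open>n\<close>. As \<open>c\<close> may have either sign,
  the opposite direction is covered too.\<close>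

lemma improving_impulse_move: "improving (\<lambda>t. impulse n c t - impulse 0 c t)"
proof (cases "n = 0")
  case True
  then show ?thesis
    using improving_zero by simp
next
  case False
  then have "impulse n c = (impulse 0 c)(0 := impulse 0 c n, n := impulse 0 c 0)"
    by (auto simp: impulse_def fun_eq_iff)
  then have "indifferent R (impulse n c) (impulse 0 c)"
    using A2 bounded_streams_impulse False unfolding A2_interchange_def by metis
  then show ?thesis
    using R_iff_improving bounded_streams_impulse by (auto simp: indifferent_def)
qed

text \<open>The entries of the truncation are moved to the first period one at a time.\<close>

lemma improving_truncate: "improving (\<lambda>t. truncate n w t - impulse 0 (partial_sum n w) t)"
proof (induction n)
  case 0
  have "(\<lambda>t. truncate 0 w t - impulse 0 (partial_sum 0 w) t) = (\<lambda>t. 0)"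
    by (simp add: truncate_def impulse_def partial_sum_def fun_eq_iff)
  then show ?case
    using improving_zero by simp
next
  case (Suc n)
  have "improving (\<lambda>t. (truncate n w t - impulse 0 (partial_sum n w) t)
      + (impulse n (w n) t - impulse 0 (w n) t))"
    by (intro improving_add Suc improving_impulse_move)
  moreover have "(truncate n w t - impulse 0 (partial_sum n w) t)
      + (impulse n (w n) t - impulse 0 (w n) t)
      = truncate (Suc n) w t - impulse 0 (partial_sum (Suc n) w) t" for t
    by (auto simp: truncate_def impulse_def partial_sum_def)
  ultimately show ?case
    by simp
qed

text \<open>A3 yields only a weak preference. Comparing \<open>w\<close> with a unit received at
  once, rather than with zero, leaves a margin that rules out \<open>- w\<close>.\<close>

lemma improving_if_partial_sums_at_top:
  assumes w: "w \<in> bounded_streams"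
    and lim: "filterlim (\<lambda>n. partial_sum n w) at_top sequentially"
  shows "improving w" "\<not> improving (\<lambda>t. - w t)"
proof -
  obtain N where N: "\<And>n. N \<le> n \<Longrightarrow> 1 < partial_sum n w"
    using lim by (auto simp: filterlim_at_top_dense eventually_sequentially)
  \<comment> \<open>\<open>2 \<le> n\<close> provides the \<open>N > 1\<close> of A3 and makes
    truncation leave the unit impulse unchanged.\<close>
  have "strictly_preferred R (truncate n w) (truncate n (impulse 0 1))" if n: "max N 2 \<le> n" for n
  proof -
    have tr: "truncate n (impulse 0 1) = impulse 0 1"
      using n by (auto simp: truncate_def impulse_def fun_eq_iff)
    have "improving (\<lambda>t. (truncate n w t - impulse 0 (partial_sum n w) t)
        + impulse 0 (partial_sum n w - 1) t)"
      using N[of n] n by (intro improving_add improving_truncate) (simp add: improving_impulse_iff)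
    moreover have "(truncate n w t - impulse 0 (partial_sum n w) t)
        + impulse 0 (partial_sum n w - 1) t = truncate n w t - impulse 0 1 t" for t
      by (simp add: impulse_def)
    ultimately have "improving (\<lambda>t. truncate n w t - impulse 0 1 t)"
      by simp
    moreover have "\<not> improving (\<lambda>t. impulse 0 1 t - truncate n w t)"
    proof
      assume "improving (\<lambda>t. impulse 0 1 t - truncate n w t)"
      \<comment> \<open>The truncation cancels, and what is left is an impulse of negative size
        \<open>1 - partial_sum n w\<close>.\<close>
      from improving_add[OF this improving_truncate[of n w]]
      have "improving (\<lambda>t. impulse 0 1 t - impulse 0 (partial_sum n w) t)"
        by simp
      also have "(\<lambda>t. impulse 0 1 t - impulse 0 (partial_sum n w) t)
          = impulse 0 (1 - partial_sum n w)"
        by (simp add: impulse_def fun_eq_iff)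
      finally show False
        using N[of n] n by (simp add: improving_impulse_iff)
    qed
    ultimately show ?thesis
      by (simp add: strictly_preferred_def tr R_iff_improving bounded_streams_intros)
  qed
  then have "(w, impulse 0 1) \<in> R"
    using A3[unfolded A3_truncation_def, rule_format, OF w bounded_streams_impulse[of 0 1]]
    by (meson less_le_trans max.cobounded2 one_less_numeral_iff semiring_norm(76))
  then have *: "improving (\<lambda>t. w t - impulse 0 1 t)"
    by (simp add: R_iff_improving w bounded_streams_impulse)
  show "improving w"
    using improving_add[OF *, of "impulse 0 1"] by (simp add: improving_impulse_iff)
  show "\<not> improving (\<lambda>t. - w t)"
  proof
    assume "improving (\<lambda>t. - w t)"
    from improving_add[OF * this] have "improving (\<lambda>t. - impulse 0 1 t)"
      by simp
    also have "(\<lambda>t. - impulse 0 1 t) = impulse 0 (- 1)"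
      by (simp add: impulse_def fun_eq_iff)
    finally show False
      by (simp add: improving_impulse_iff)
  qed
qed

text \<open>A7 concerns the streams below a given one. Those below zero are the negatives of the
  improving streams, so closedness passes to the latter.\<close>

lemma improving_limit:
  assumes improving: "\<And>n. improving (z n)" and Z: "Z \<in> bounded_streams"
    and lim: "(\<lambda>n. stream_dist (z n) Z) \<longlonglongrightarrow> 0"
  shows "improving Z"
proof -
  define N where "N = {v \<in> bounded_streams. ((\<lambda>t. 0), v) \<in> R}"
  have N_iff: "(\<lambda>t. - v t) \<in> N \<longleftrightarrow> improving v" if "v \<in> bounded_streams" for v
    using that R_iff_improving[OF bounded_streams_zero bounded_streams_uminus[OF that]]
    by (simp add: N_def bounded_streams_uminus)
  have "closedin stream_metric.mtopology N"
    using A7 bounded_streams_zero by (simp add: A7_closed_def N_def)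
  moreover have "limitin stream_metric.mtopology (\<lambda>n t. - z n t) (\<lambda>t. - Z t) sequentially"
    unfolding stream_metric.limitin_metric_dist_null
  proof (intro conjI)
    have "stream_dist (\<lambda>t. - z n t) (\<lambda>t. - Z t) = stream_dist (z n) Z" for n
      by (simp add: stream_dist_def abs_minus_commute)
    then show "(\<lambda>n. stream_dist (\<lambda>t. - z n t) (\<lambda>t. - Z t)) \<longlonglongrightarrow> 0"
      using lim by simp
    show "eventually (\<lambda>n. (\<lambda>t. - z n t) \<in> bounded_streams) sequentially"
      using improving_bounded[OF improving] by (simp add: bounded_streams_uminus)
  qed (rule bounded_streams_uminus[OF Z])
  moreover have "eventually (\<lambda>n. (\<lambda>t. - z n t) \<in> N) sequentially"
    using improving improving_bounded N_iff by simp
  ultimately have "(\<lambda>t. - Z t) \<in> N"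
    using limitin_closedin by (metis trivial_limit_sequentially)
  then show ?thesis
    using N_iff[OF Z] by simp
qed

text \<open>The truncations, each with its total taken away in the first period, are improving and
  converge to the stated stream in \<open>stream_dist\<close>.\<close>

lemma improving_summable:
  assumes sm: "summable (\<lambda>t. \<bar>w t\<bar>)" and w: "w \<in> bounded_streams"
  shows "improving (\<lambda>t. w t - impulse 0 (suminf w) t)"
proof (rule improving_limit)
  define z where "z n = (\<lambda>t. truncate n w t - impulse 0 (partial_sum n w) t)" for n
  show "improving (z n)" for n
    unfolding z_def by (rule improving_truncate)
  show "(\<lambda>t. w t - impulse 0 (suminf w) t) \<in> bounded_streams"
    using w by (intro bounded_streams_intros)
  \<comment> \<open>The tail of the absolute series from index \<open>n\<close> on, plus the change
    in the amount taken away in the first period.\<close>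
  define b where "b n = (suminf (\<lambda>t. \<bar>w t\<bar>) - (\<Sum>t<n. \<bar>w t\<bar>)) + \<bar>suminf w - partial_sum n w\<bar>" for n
  have le: "stream_dist (z n) (\<lambda>t. w t - impulse 0 (suminf w) t) \<le> b n" for n
  proof (rule stream_dist_le)
    fix m
    have "(\<Sum>t<m. \<bar>z n t - (w t - impulse 0 (suminf w) t)\<bar>)
        \<le> (\<Sum>t<m. (if n \<le> t then \<bar>w t\<bar> else 0) + impulse 0 \<bar>suminf w - partial_sum n w\<bar> t)"
      by (intro sum_mono) (auto simp: z_def truncate_def impulse_def)
    also have "\<dots> = (\<Sum>t<m. if n \<le> t then \<bar>w t\<bar> else 0)
        + (\<Sum>t<m. impulse 0 \<bar>suminf w - partial_sum n w\<bar> t)"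
      by (rule sum.distrib)
    also have "(\<Sum>t<m. impulse 0 \<bar>suminf w - partial_sum n w\<bar> t) \<le> \<bar>suminf w - partial_sum n w\<bar>"
      by (simp add: impulse_def)
    also have "(\<Sum>t<m. if n \<le> t then \<bar>w t\<bar> else 0) \<le> suminf (\<lambda>t. \<bar>w t\<bar>) - (\<Sum>t<n. \<bar>w t\<bar>)"
    proof -
      have "(\<Sum>t<n. \<bar>w t\<bar>) + (\<Sum>t<m. if n \<le> t then \<bar>w t\<bar> else 0) \<le> (\<Sum>t<n + m. \<bar>w t\<bar>)"
      proof -
        have "(\<Sum>t<m. if n \<le> t then \<bar>w t\<bar> else 0) = (\<Sum>t\<in>{t\<in>{..<m}. n \<le> t}. \<bar>w t\<bar>)"
          by (rule sum.inter_filter[symmetric]) simp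
        also have "(\<Sum>t<n. \<bar>w t\<bar>) + \<dots> = (\<Sum>t\<in>{..<n} \<union> {t\<in>{..<m}. n \<le> t}. \<bar>w t\<bar>)"
          by (rule sum.union_disjoint[symmetric]) auto
        also have "\<dots> \<le> (\<Sum>t<n + m. \<bar>w t\<bar>)"
          by (rule sum_mono2) auto
        finally show ?thesis .
      qed
      also have "\<dots> \<le> suminf (\<lambda>t. \<bar>w t\<bar>)"
        by (intro sum_le_suminf sm) auto
      finally show ?thesis
        by simp
    qed
    finally show "(\<Sum>t<m. \<bar>z n t - (w t - impulse 0 (suminf w) t)\<bar>) \<le> b n"
      by (simp add: b_def)
  qed
  have sw: "summable w"
    using sm by (rule summable_rabs_cancel)
  have "b \<longlonglongrightarrow> (suminf (\<lambda>t. \<bar>w t\<bar>) - suminf (\<lambda>t. \<bar>w t\<bar>)) + \<bar>suminf w - suminf w\<bar>"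
    unfolding b_def partial_sum_def
    by (intro tendsto_intros summable_LIMSEQ sm sw)
  then have "b \<longlonglongrightarrow> 0"
    by simp
  then show "(\<lambda>n. stream_dist (z n) (\<lambda>t. w t - impulse 0 (suminf w) t)) \<longlonglongrightarrow> 0"
    by (rule Lim_null_comparison[rotated]) (simp add: le)
qed

text \<open>Applied to \<open>w\<close> and to \<open>- w\<close>, the previous lemma makes
  \<open>w\<close> indifferent to its total received at once, and the sign of that impulse
  decides.\<close>

lemma improving_summable_iff:
  assumes sm: "summable (\<lambda>t. \<bar>w t\<bar>)" and w: "w \<in> bounded_streams"
  shows "improving w \<longleftrightarrow> 0 \<le> suminf w"
proof
  assume "0 \<le> suminf w"
  then have "improving (impulse 0 (suminf w))"
    by (simp add: improving_impulse_iff)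
  from improving_add[OF improving_summable[OF assms] this] show "improving w"
    by simp
next
  assume "improving w"
  have "suminf (\<lambda>t. - w t) = - suminf w"
    by (rule suminf_minus[OF summable_rabs_cancel[OF sm]])
  then have "(\<lambda>t. - w t - impulse 0 (suminf (\<lambda>t. - w t)) t) = (\<lambda>t. - w t + impulse 0 (suminf w) t)"
    by (simp add: impulse_def fun_eq_iff)
  then have "improving (\<lambda>t. - w t + impulse 0 (suminf w) t)"
    using improving_summable[of "\<lambda>t. - w t"] sm w by (simp add: bounded_streams_uminus)
  from improving_add[OF \<open>improving w\<close> this] show "0 \<le> suminf w"
    by (simp add: improving_impulse_iff)
qed

section \<open>Agreement with average overtaking\<close>

lemma bounded_delayed_sum:
  assumes "w \<in> bounded_streams"
  shows "delayed_sum k w \<in> bounded_streams"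
proof -
  obtain B where B: "\<And>t. \<bar>w t\<bar> \<le> B"
    using assms by (auto simp: bounded_streams_iff)
  have "\<bar>delayed_sum k w t\<bar> \<le> (\<Sum>j<k. B)" for t
    unfolding delayed_sum_def using B order_trans[OF abs_ge_zero B]
    by (intro order_trans[OF sum_abs] sum_mono) auto
  then show ?thesis
    unfolding bounded_streams_iff by blast
qed

text \<open>\<open>k\<close> times the partial sums of \<open>w\<close> stay within a bounded
  distance of those of the delayed sum, so divergence carries over.\<close>

lemma partial_sums_at_top_of_delayed_sum:
  assumes w: "w \<in> bounded_streams" and k: "0 < k"
    and lim: "filterlim (\<lambda>n. partial_sum n (delayed_sum k w)) at_top sequentially"
  shows "filterlim (\<lambda>n. partial_sum n w) at_top sequentially"
proof -
  obtain B where B: "\<And>t. \<bar>w t\<bar> \<le> B"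
    using w by (auto simp: bounded_streams_iff)
  have "filterlim (\<lambda>n. (- (real k * (real k * B)) + partial_sum n (delayed_sum k w)) * (1 / real k))
      at_top sequentially"
    using k lim by (intro filterlim_at_top_mult_tendsto_pos[OF tendsto_const]
        filterlim_tendsto_add_at_top[OF tendsto_const]) auto
  moreover have "(- (real k * (real k * B)) + partial_sum n (delayed_sum k w)) * (1 / real k)
      \<le> partial_sum n w" for n
    using partial_sum_delayed_sum_bound[of w B k n] B k by (simp add: field_simps abs_le_iff)
  ultimately show ?thesis
    by (intro filterlim_at_top_mono[of _ sequentially "\<lambda>n. partial_sum n w"]) auto
qed

lemma improving_iff_average_overtakes:
  fixes u v :: "nat \<Rightarrow> real"
  defines "w \<equiv> (\<lambda>t. u t - v t)"
  assumes wb: "w \<in> bounded_streams"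
    and k: "0 < k"
    and decay: "geometric_decay (\<lambda>t. w (t + k) - w t)"
    and cmp: "improving w \<or> improving (\<lambda>t. - w t)"
  shows "improving w \<longleftrightarrow> average_overtakes u v"
proof -
  define V where "V = delayed_sum k w"
  have Vb: "V \<in> bounded_streams"
    unfolding V_def using wb by (rule bounded_delayed_sum)
  have upV: "improving w \<longleftrightarrow> improving V"
    using improving_iff_improving_delayed_sum[OF cmp k] by (simp add: V_def)
  obtain L where L: "geometric_decay (\<lambda>t. V (t + k) - L)"
    using delayed_sum_limit[OF decay] unfolding V_def .
  have "(\<lambda>t. V (t + k) - L) \<longlonglongrightarrow> 0"
    using summable_LIMSEQ_zero[OF geometric_decay_summable[OF L]] by (rule tendsto_rabs_zero_cancel)
  then have V: "V \<longlonglongrightarrow> L"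
    by (rule LIMSEQ_offset[OF LIM_zero_cancel])
  consider "0 < L" | "L < 0" | "L = 0"
    by linarith
  then show ?thesis
  proof cases
    case 1
    have "eventually (\<lambda>t. L / 2 < V t) sequentially"
      by (rule order_tendstoD(1)[OF V]) (use 1 in simp)
    then have "eventually (\<lambda>t. L / 2 \<le> V t) sequentially"
      by eventually_elim simp
    then have lim: "filterlim (\<lambda>n. partial_sum n V) at_top sequentially"
      by (rule partial_sum_at_top[rotated]) (use 1 in simp)
    \<comment> \<open>The preference is settled through \<open>V\<close>, average overtaking through
      \<open>w\<close>, so divergence is transferred to \<open>w\<close>.\<close>
    have "filterlim (\<lambda>n. partial_sum n w) at_top sequentially"
      using lim unfolding V_def by (rule partial_sums_at_top_of_delayed_sum[OF wb k])
    then have "eventually (\<lambda>n. 0 \<le> partial_sum n w) sequentially"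
      by (simp add: filterlim_at_top)
    then have "average_overtakes u v"
      unfolding average_overtakes_iff w_def by (intro allI impI mean_lower_bound)
    then show ?thesis
      using improving_if_partial_sums_at_top(1)[OF Vb lim] upV by simp
  next
    case 2
    have "eventually (\<lambda>t. V t < L / 2) sequentially"
      by (rule order_tendstoD(2)[OF V]) (use 2 in simp)
    then have "eventually (\<lambda>t. - L / 2 \<le> - V t) sequentially"
      by eventually_elim simp
    then have lim: "filterlim (\<lambda>n. partial_sum n (\<lambda>t. - V t)) at_top sequentially"
      by (rule partial_sum_at_top[rotated]) (use 2 in simp)
    have "filterlim (\<lambda>n. partial_sum n (\<lambda>t. - w t)) at_top sequentially"
      by (rule partial_sums_at_top_of_delayed_sum[OF bounded_streams_uminus[OF wb] k])
        (use lim in \<open>simp only: V_def delayed_sum_uminus\<close>)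
    \<comment> \<open>The bound 2 makes the means of the negated partial sums exceed 1, against
      average overtaking at \<open>b = - 1\<close>.\<close>
    then have "eventually (\<lambda>n. 2 \<le> - partial_sum n w) sequentially"
      by (simp add: filterlim_at_top partial_sum_uminus)
    then have ev: "eventually (\<lambda>T. 1 < (1 / real T) * (\<Sum>t=1..T. - partial_sum t w)) sequentially"
      by (rule mean_lower_bound) simp
    have "\<not> average_overtakes u v"
    proof
      assume "average_overtakes u v"
      then have "eventually (\<lambda>T. - 1 < (1 / real T) * (\<Sum>t=1..T. partial_sum t w)) sequentially"
        unfolding average_overtakes_iff w_def by simp
      with ev have "eventually (\<lambda>T :: nat. False) sequentially"
        by eventually_elim (simp add: sum_negf)
      then show False
        by simp
    qed
    moreover have "\<not> improving V"
      using improving_if_partial_sums_at_top(2)[OF bounded_streams_uminus[OF Vb] lim] by simp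
    ultimately show ?thesis
      using upV by simp
  next
    case 3
    have "summable (\<lambda>t. \<bar>V (t + k)\<bar>)"
      using geometric_decay_summable[OF L] 3 by simp
    then have sm: "summable (\<lambda>t. \<bar>V t\<bar>)"
      by (simp only: summable_iff_shift[of "\<lambda>t. \<bar>V t\<bar>" k])
    obtain B where B: "\<And>t. \<bar>w t\<bar> \<le> B"
      using wb by (auto simp: bounded_streams_iff)
    have "(\<lambda>n. partial_sum n V) \<longlonglongrightarrow> suminf V"
      unfolding partial_sum_def using summable_rabs_cancel[OF sm] by (rule summable_LIMSEQ)
    then have "(\<lambda>T. (1 / real T) * (\<Sum>t=1..T. partial_sum t w)) \<longlonglongrightarrow> suminf V / real k"
      unfolding V_def by (rule mean_partial_sum_tendsto[OF B k])
    then have "average_overtakes u v \<longleftrightarrow> 0 \<le> suminf V / real k"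
      unfolding w_def by (rule average_overtakes_limit)
    then show ?thesis
      using k improving_summable_iff[OF sm Vb] upV by (simp add: zero_le_divide_iff)
  qed
qed

end

theorem theorem2:
  fixes p :: "'a::finite \<Rightarrow> 's::finite \<Rightarrow> 's \<Rightarrow> real"
    and r :: "'s \<Rightarrow> 'a \<Rightarrow> real"
    and R :: "(nat \<Rightarrow> real) rel"
  assumes "transition_probs p"
    and "preorder_on bounded_streams R"
    and "A1_monotone R"
    and "A2_interchange R"
    and "A3_truncation R"
    and "A4_stationarity R"
    and "A5_translation R"
    and "A6_comparable (stationary_streams p r) R"
    and "A7_closed R"
  shows "\<forall>u\<in>stationary_streams p r. \<forall>v\<in>stationary_streams p r.
           (u, v) \<in> R \<longleftrightarrow> average_overtakes u v"
proof (intro ballI)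
  fix u v
  assume uv: "u \<in> stationary_streams p r" "v \<in> stationary_streams p r"
  interpret preference R
    using assms by unfold_locales
  have b: "u \<in> bounded_streams" "v \<in> bounded_streams"
    using stationary_stream_bounded[OF assms(1)] uv by blast+
  obtain k where k: "0 < k" "geometric_decay (\<lambda>t. u (t + k) - u t)"
    using stationary_stream_asymptotically_periodic[OF assms(1) uv(1)] .
  obtain l where l: "0 < l" "geometric_decay (\<lambda>t. v (t + l) - v t)"
    using stationary_stream_asymptotically_periodic[OF assms(1) uv(2)] .
  \<comment> \<open>The common period \<open>k * l\<close> consists of \<open>l\<close> periods of
    \<open>u\<close> and of \<open>k\<close> periods of \<open>v\<close>.\<close>
  have "geometric_decay (\<lambda>t. (u (t + l * k) - u t) - (v (t + k * l) - v t))"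
    by (intro geometric_decay_diff geometric_decay_period_mult k l)
  then have "geometric_decay (\<lambda>t. (u (t + k * l) - v (t + k * l)) - (u t - v t))"
    by (simp add: algebra_simps)
  \<comment> \<open>A6 for the pair \<open>u\<close>, \<open>v\<close> becomes comparability of
    their difference with zero.\<close>
  moreover have "improving (\<lambda>t. u t - v t) \<or> improving (\<lambda>t. - (u t - v t))"
    using assms(8) uv R_iff_improving[OF b] R_iff_improving[OF b(2,1)] by (auto simp: A6_comparable_def)
  ultimately show "(u, v) \<in> R \<longleftrightarrow> average_overtakes u v"
    using improving_iff_average_overtakes[of u v "k * l"] k l b
    by (simp add: R_iff_improving bounded_streams_diff)
qed

end
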